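(* Let $\alpha\in[0,1]$, let $n\ge 3$, and let $d_1,\dots,d_t$ be the distinct proper divisors of $n$ (divisors $d$ with $1<d<n$). For $i\neq k$ put $d(v_i,v_k)=1$ if one of $d_i,d_k$ divides the other, and $d(v_i,v_k)=2$ otherwise. The spectrum (as a multiset) of the generalized reciprocal distance matrix $RD_\alpha(P(\mathbb{Z}_n))$ of the power graph of the cyclic group $\mathbb{Z}_n$ consists of: the eigenvalue $n\alpha-1$ with multiplicity $\phi(n)$; for each $1\le i\le t$, the eigenvalue $$\left(\phi(n)+\phi(d_i)+\sum_{\substack{k=1\\k\ne i}}^{t}\frac{\phi(d_k)}{d(v_i,v_k)}+1\right)\alpha-1$$ with multiplicity $\phi(d_i)-1$; and the $t+1$ eigenvalues of the matrix $$\mathcal{Q}^{RD_\alpha}=\begin{pmatrix} \alpha(n-1-\phi(n))+\phi(n) & (1-\alpha)\phi(d_1) & \cdots & (1-\alpha)\phi(d_t)\\ (1-\alpha)(\phi(n)+1) & h_1 & \cdots & \frac{(1-\alpha)\phi(d_t)}{d(v_1,v_t)}\\ \vdots & \vdots & \ddots & \vdots\\ (1-\alpha)(\phi(n)+1) & \frac{(1-\alpha)\phi(d_1)}{d(v_t,v_1)} & \cdots & h_t \end{pmatrix},$$ where $h_i=\alpha\left(\phi(n)+\sum_{k=1,\,k\ne i}^{t}\frac{\phi(d_k)}{d(v_i,v_k)}+1\right)+\phi(d_i)-1$, and for $i\ne k$ the entry in the row of $d_i$ and column of $d_k$ is $\frac{(1-\alpha)\phi(d_k)}{d(v_i,v_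k)}$.
   Context: For a finite group $\mathcal{G}$, the power graph $P(\mathcal{G})$ is the simple graph with vertex set $\mathcal{G}$ in which two distinct elements are adjacent if one is a positive power of the other. $\phi$ is Euler's totient function. For a connected graph $\Gamma$ with distance $d$, $RD(\Gamma)$ has $(u,v)$ entry $1/d(u,v)$ for $u\neq v$ and $0$ on the diagonal; $RT_r(\Gamma)$ is the diagonal matrix with entries $RT_r(v)=\sum_{u\ne v}1/d(v,u)$; $RD_\alpha(\Gamma)=\alpha RT_r(\Gamma)+(1-\alpha)RD(\Gamma)$. The number $d(v_i,v_k)$ is the distance, in the power graph, between an element of order $d_i$ and an element of order $d_k$. *)

theory Defs
  imports
    "HOL-Algebra.Elementary_Groups"
    "HOL-Number_Theory.Totient"
    "HOL-Computational_Algebra.Polynomial"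
    "Graph_Theory.Pair_Digraph"
    "Graph_Theory.Shortest_Path"
    "Jordan_Normal_Form.Char_Poly"
begin

definition power_graph :: "('a, 'b) monoid_scheme \<Rightarrow> 'a pair_pre_digraph" where
  "power_graph G = \<lparr> pverts = carrier G,
     parcs = {(x, y). x \<in> carrier G \<and> y \<in> carrier G \<and> x \<noteq> y \<and>
       (\<exists>m::nat. m > 0 \<and> (y = x [^]\<^bsub>G\<^esub> m \<or> x = y [^]\<^bsub>G\<^esub> m))} \<rparr>"

text \<open>A simple graph is represented by its symmetric loop-free digraph.\<close>

lemma pair_graph_power_graph:
  assumes "finite (carrier G)"
  shows "pair_graph (power_graph G)"
proof -
  have fin: "finite (parcs (power_graph G))"
    by (rule finite_subset[of _ "carrier G \<times> carrier G"])
      (use assms in \<open>auto simp: power_graph_def\<close>)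
  have "symmetric (with_proj (power_graph G))"
    unfolding symmetric_def by (auto simp: power_graph_def sym_def)
  with fin assms show ?thesis
    by unfold_locales (auto simp: power_graph_def)
qed

text \<open>Shortest paths with unit arc weights. Since 0 is the real value of an infinite
  distance, this is the graph distance only between vertices joined by a walk; the
  reciprocal below is meant for connected graphs.\<close>

definition graph_dist :: "'a pair_pre_digraph \<Rightarrow> 'a \<Rightarrow> 'a \<Rightarrow> real" where
  "graph_dist \<Gamma> u v = real_of_ereal (wf_digraph.\<mu> (with_proj \<Gamma>) (\<lambda>_. 1) u v)"

definition reciprocal_transmission :: "'a pair_pre_digraph \<Rightarrow> 'a \<Rightarrow> real" where
  "reciprocal_transmission \<Gamma> v = (\<Sum>u \<in> pverts \<Gamma> - {v}. 1 / graph_dist \<Gamma> v u)"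

text \<open>Matrices of a graph are taken with respect to an enumeration \<open>vs\<close> of its vertices
  (a distinct list with \<open>set vs = pverts \<Gamma>\<close>).\<close>

definition RD :: "'a pair_pre_digraph \<Rightarrow> 'a list \<Rightarrow> real mat" where
  "RD \<Gamma> vs = mat (length vs) (length vs)
     (\<lambda>(i, j). if i = j then 0 else 1 / graph_dist \<Gamma> (vs ! i) (vs ! j))"

definition RT :: "'a pair_pre_digraph \<Rightarrow> 'a list \<Rightarrow> real mat" where
  "RT \<Gamma> vs = mat_diag (length vs) (\<lambda>i. reciprocal_transmission \<Gamma> (vs ! i))"

definition RD_alpha :: "real \<Rightarrow> 'a pair_pre_digraph \<Rightarrow> 'a list \<Rightarrow> real mat" where
  "RD_alpha \<alpha> \<Gamma> vs = \<alpha> \<cdot>\<^sub>m RT \<Gamma> vs + (1 - \<alpha>) \<cdot>\<^sub>m RD \<Gamma> vs"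

text \<open>All eigenvalues with algebraic multiplicity. They are taken over the complex numbers,
  so that no eigenvalue of a real matrix is lost.\<close>

definition spectrum_mset :: "real mat \<Rightarrow> complex multiset" where
  "spectrum_mset A = proots (char_poly (map_mat complex_of_real A))"

definition div_dist :: "nat \<Rightarrow> nat \<Rightarrow> real" where
  "div_dist d e = (if d dvd e \<or> e dvd d then 1 else 2)"

text \<open>In the following, \<open>ds\<close> lists the proper divisors of \<open>n\<close>, and \<open>ds ! i\<close> is
  $d_{i+1}$.\<close>

definition cross_sum :: "nat list \<Rightarrow> nat \<Rightarrow> real" where
  "cross_sum ds i =
     (\<Sum>k \<in> {..<length ds} - {i}. real (totient (ds ! k)) / div_dist (ds ! i) (ds ! k))"

definition h_entry :: "real \<Rightarrow> nat \<Rightarrow> nat list \<Rightarrow> nat \<Rightarrow> real" where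
  "h_entry \<alpha> n ds i =
     \<alpha> * (real (totient n) + cross_sum ds i + 1) + real (totient (ds ! i)) - 1"

text \<open>Row and column 0 belong to the class of the identity and the generators; row and
  column \<open>Suc i\<close> belong to the elements of order \<open>ds ! i\<close>.\<close>

definition Q_RD_alpha :: "real \<Rightarrow> nat \<Rightarrow> nat list \<Rightarrow> real mat" where
  "Q_RD_alpha \<alpha> n ds = mat (length ds + 1) (length ds + 1) (\<lambda>(r, c).
     case (r, c) of
       (0, 0) \<Rightarrow> \<alpha> * (real n - 1 - real (totient n)) + real (totient n)
     | (0, Suc k) \<Rightarrow> (1 - \<alpha>) * real (totient (ds ! k))
     | (Suc i, 0) \<Rightarrow> (1 - \<alpha>) * (real (totient n) + 1)
     | (Suc i, Suc k) \<Rightarrow>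
         if i = k then h_entry \<alpha> n ds i
         else (1 - \<alpha>) * real (totient (ds ! k)) / div_dist (ds ! i) (ds ! k))"

end

theory Submission
  imports Defs
begin

text \<open>Any two elements of \<open>integer_mod_group n\<close> are at distance 1 or 2 in the power graph, and
  which of the two holds depends only on whether one of their orders divides the other. The identity
  and the generators are adjacent to everything and can be put into one class. So the entries of the
  matrix depend only on the classes of their indices, up to a class-dependent diagonal term:
  the matrix is \<open>\<Delta> + P B P\<^sup>T\<close> with \<open>P\<close> the incidence matrix of the classes. The determinant
  identity \<open>det (1 - U V) = det (1 - V U)\<close> reduces its characteristic polynomial to that of the
  quotient matrix, and each class of size \<open>s\<close> leaves \<open>s - 1\<close> factors \<open>x - D\<close>.\<close>

section \<open>Characteristic polynomials of matrices that are constant on classes up to a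
  diagonal\<close>

text \<open>The unipotent factor \<open>?L\<close> clears the lower left block of \<open>?M\<close>
  from either side. Both products are block triangular, with \<open>1 - U * V\<close> or
  \<open>1 - V * U\<close> as the only nontrivial diagonal block.\<close>

lemma det_one_minus_mult_commute:
  fixes U V :: "'a :: idom mat"
  assumes U: "U \<in> carrier_mat n m" and V: "V \<in> carrier_mat m n"
  shows "det (1\<^sub>m n - U * V) = det (1\<^sub>m m - V * U)"
proof -
  let ?M = "four_block_mat (1\<^sub>m n) U V (1\<^sub>m m)"
  let ?L = "four_block_mat (1\<^sub>m n) (0\<^sub>m n m) (- V) (1\<^sub>m m)"
  have UV: "1\<^sub>m n - U * V \<in> carrier_mat n n" and VU: "1\<^sub>m m - V * U \<in> carrier_mat m m"
    using U V by auto
  have M: "?M \<in> carrier_mat (n + m) (n + m)" and L: "?L \<in> carrier_mat (n + m) (n + m)"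
    using U V by auto
  have neg: "U * (- V) = - (U * V)" "- V * U = - (V * U)" using U V by auto
  have M_L: "?M * ?L = four_block_mat (1\<^sub>m n - U * V) U (0\<^sub>m m n) (1\<^sub>m m)"
    by (subst mult_four_block_mat) (use U V neg in \<open>auto intro!: cong_four_block_mat\<close>)
  have L_M: "?L * ?M = four_block_mat (1\<^sub>m n) U (0\<^sub>m m n) (1\<^sub>m m - V * U)"
    by (subst mult_four_block_mat) (use U V neg in \<open>auto intro!: cong_four_block_mat\<close>)
  have "det (1\<^sub>m n - U * V) = det (?M * ?L)"
    unfolding M_L by (subst det_four_block_mat_lower_left_zero[of _ n _ m]) (use U UV in auto)
  also have "\<dots> = det (?L * ?M)"
    by (simp add: det_mult[OF M L] det_mult[OF L M])
  also have "\<dots> = det (1\<^sub>m m - V * U)"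
    unfolding L_M by (subst det_four_block_mat_lower_left_zero[of _ n _ m]) (use U VU in auto)
  finally show ?thesis .
qed

lemma det_mat_diag: "det (mat_diag n f) = (\<Prod>i<n. f i)"
proof -
  have "det (mat_diag n f) = prod_list (diag_mat (mat_diag n f))"
    by (rule det_upper_triangular[where n = n]) (auto simp: mat_diag_def)
  also have "\<dots> = (\<Prod>i<n. f i)"
    by (simp add: prod_list_diag_prod mat_diag_def lessThan_atLeast0)
  finally show ?thesis .
qed

text \<open>\<open>c i\<close> is the class of the index \<open>i\<close>, and \<open>s l\<close> the size of the class \<open>l\<close>.\<close>

definition class_mat ::
    "nat \<Rightarrow> (nat \<Rightarrow> nat) \<Rightarrow> (nat \<Rightarrow> 'a) \<Rightarrow> (nat \<Rightarrow> nat \<Rightarrow> 'a) \<Rightarrow> 'a :: comm_ring_1 mat" where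
  "class_mat N c D B = mat N N (\<lambda>(i, j). (if i = j then D (c i) else 0) + B (c i) (c j))"

text \<open>When \<open>s\<close> gives the class sizes, entry \<open>(k, l)\<close> is the sum over
  class \<open>l\<close> of any row of \<open>class_mat\<close> in class \<open>k\<close>: the
  quotient by an equitable partition.\<close>

definition quotient_mat ::
    "nat \<Rightarrow> (nat \<Rightarrow> nat) \<Rightarrow> (nat \<Rightarrow> 'a) \<Rightarrow> (nat \<Rightarrow> nat \<Rightarrow> 'a) \<Rightarrow> 'a :: comm_ring_1 mat" where
  "quotient_mat m s D B = mat m m (\<lambda>(k, l). (if k = l then D k else 0) + B k l * of_nat (s l))"

lemma class_mat_carrier [simp]: "class_mat N c D B \<in> carrier_mat N N"
  by (simp add: class_mat_def)

lemma quotient_mat_carrier [simp]: "quotient_mat m s D B \<in> carrier_mat m m"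
  by (simp add: quotient_mat_def)

text \<open>Away from the values \<open>D k\<close> the diagonal part of \<open>x - A\<close> is
  invertible and can be factored out of both matrices. \<open>U\<close> is the incidence matrix with
  columns divided by \<open>x - D k\<close>, and \<open>V\<close> is \<open>B\<close> times the
  transposed incidence matrix.\<close>

lemma poly_char_poly_class_mat:
  fixes D :: "nat \<Rightarrow> 'a :: field"
  assumes c: "\<And>i. i < N \<Longrightarrow> c i < m"
    and s: "\<And>k. k < m \<Longrightarrow> s k = card {i. i < N \<and> c i = k}"
    and x: "\<And>k. k < m \<Longrightarrow> x \<noteq> D k"
  shows "poly (char_poly (class_mat N c D B)) x * (\<Prod>k<m. x - D k)
    = (\<Prod>k<m. (x - D k) ^ s k) * poly (char_poly (quotient_mat m s D B)) x"
proof -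
  define U where "U = mat N m (\<lambda>(i, k). if c i = k then 1 / (x - D k) else 0)"
  define V where "V = mat m N (\<lambda>(k, j). B k (c j))"
  have U: "U \<in> carrier_mat N m" and V: "V \<in> carrier_mat m N"
    by (auto simp: U_def V_def)
  have UV: "(U * V) $$ (i, j) = B (c i) (c j) / (x - D (c i))" if "i < N" "j < N" for i j
  proof -
    have "(U * V) $$ (i, j) = (\<Sum>k<m. (if c i = k then 1 / (x - D k) else 0) * B k (c j))"
      using that by (simp add: U_def V_def scalar_prod_def lessThan_atLeast0)
    also have "\<dots> = (\<Sum>k<m. if k = c i then B k (c j) / (x - D k) else 0)"
      by (rule sum.cong) auto
    finally show ?thesis using c[OF that(1)] by simp
  qed
  have VU: "(V * U) $$ (k, l) = B k l * of_nat (s l) / (x - D l)" if "k < m" "l < m" for k l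
  proof -
    have "(V * U) $$ (k, l) = (\<Sum>j<N. B k (c j) * (if c j = l then 1 / (x - D l) else 0))"
      using that by (simp add: U_def V_def scalar_prod_def lessThan_atLeast0)
    also have "\<dots> = (\<Sum>j<N. if c j = l then B k l / (x - D l) else 0)"
      by (rule sum.cong) auto
    also have "\<dots> = (\<Sum>j\<in>{j. j < N \<and> c j = l}. B k l / (x - D l))"
      by (subst sum.inter_filter[symmetric]) (auto intro!: sum.cong)
    finally show ?thesis using s[OF that(2)] by simp
  qed
  have C1: "1\<^sub>m N - U * V \<in> carrier_mat N N" and C2: "1\<^sub>m m - V * U \<in> carrier_mat m m"
    by (intro minus_carrier_mat mult_carrier_mat[OF U V] mult_carrier_mat[OF V U])+
  have x': "x \<noteq> D (c i)" if "i < N" for i using x c that by blast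
  have left: "- char_matrix (class_mat N c D B) x
      = mat_diag N (\<lambda>i. x - D (c i)) * (1\<^sub>m N - U * V)"
    by (subst mat_diag_mult_left[OF C1], rule eq_matI)
      (use x c U V in \<open>auto simp: char_matrix_def class_mat_def UV x' right_diff_distrib simp del: index_mult_mat(1)\<close>)
  \<comment> \<open>In \<open>V * U\<close> the division by \<open>x - D l\<close> acts on columns,
    in \<open>U * V\<close> on rows, so the diagonal factor moves to the right.\<close>
  have right: "- char_matrix (quotient_mat m s D B) x
      = (1\<^sub>m m - V * U) * mat_diag m (\<lambda>k. x - D k)"
    by (subst mat_diag_mult_right[OF C2], rule eq_matI)
      (use x U V in \<open>auto simp: char_matrix_def quotient_mat_def VU left_diff_distrib simp del: index_mult_mat(1)\<close>)
  have "(\<Prod>k<m. (x - D k) ^ s k) = (\<Prod>k<m. \<Prod>i\<in>{i \<in> {..<N}. c i = k}. x - D (c i))"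
    by (rule prod.cong) (auto simp: s)
  also have "\<dots> = (\<Prod>i<N. x - D (c i))"
    by (rule prod.group) (use c in auto)
  finally have p: "(\<Prod>i<N. x - D (c i)) = (\<Prod>k<m. (x - D k) ^ s k)" ..
  show ?thesis
    unfolding char_poly_matrix[OF class_mat_carrier] char_poly_matrix[OF quotient_mat_carrier]
      left right
    by (simp only: det_mult[OF mat_diag_dim C1] det_mult[OF C2 mat_diag_dim] det_mat_diag p
        det_one_minus_mult_commute[OF U V] mult.assoc)
qed

text \<open>The pointwise identity fails for at most finitely many arguments, and a field of
  characteristic 0 is infinite. Nonempty classes make \<open>s k - 1\<close> a true subtraction, so
  one factor \<open>x - D k\<close> can be cancelled per class.\<close>

lemma char_poly_class_mat:
  fixes D :: "nat \<Rightarrow> 'a :: field_char_0"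
  assumes c: "\<And>i. i < N \<Longrightarrow> c i < m"
    and s: "\<And>k. k < m \<Longrightarrow> s k = card {i. i < N \<and> c i = k}"
    and pos: "\<And>k. k < m \<Longrightarrow> 0 < s k"
  shows "char_poly (class_mat N c D B)
    = (\<Prod>k<m. [:- D k, 1:] ^ (s k - 1)) * char_poly (quotient_mat m s D B)"
    (is "?p = ?q")
proof (rule ccontr)
  assume "?p \<noteq> ?q"
  then have "finite {x. poly (?p - ?q) x = 0}"
    by (intro poly_roots_finite) simp
  moreover have "poly (?p - ?q) x = 0" if "x \<notin> D ` {..<m}" for x
  proof -
    have x: "\<And>k. k < m \<Longrightarrow> x \<noteq> D k" using that by auto
    have "(x - D k) ^ s k = (x - D k) ^ (s k - 1) * (x - D k)" if "k < m" for k
      by (rule power_minus_mult[OF pos[OF that], symmetric])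
    then have "(\<Prod>k<m. (x - D k) ^ s k) = (\<Prod>k<m. (x - D k) ^ (s k - 1) * (x - D k))"
      by (intro prod.cong) auto
    then have "poly ?p x * (\<Prod>k<m. x - D k) = poly ?q x * (\<Prod>k<m. x - D k)"
      using poly_char_poly_class_mat[OF c s x, where B = B] by (simp add: prod.distrib poly_prod)
    moreover have "(\<Prod>k<m. x - D k) \<noteq> 0" using x by simp
    ultimately show ?thesis by simp
  qed
  then have "- (D ` {..<m}) \<subseteq> {x. poly (?p - ?q) x = 0}" by blast
  ultimately have "finite (- (D ` {..<m}))" by (rule finite_subset[rotated])
  then show False
    by (meson finite_imageI finite_lessThan finite_compl infinite_UNIV_char_0)
qed

lemma spectrum_mset_class_mat:
  assumes "\<And>i. i < N \<Longrightarrow> c i < m"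
    and "\<And>k. k < m \<Longrightarrow> s k = card {i. i < N \<and> c i = k}"
    and "\<And>k. k < m \<Longrightarrow> 0 < s k"
  shows "spectrum_mset (class_mat N c D B)
    = (\<Sum>k<m. replicate_mset (s k - 1) (complex_of_real (D k)))
      + spectrum_mset (quotient_mat m s D B)"
proof -
  let ?D = "\<lambda>k. complex_of_real (D k)" and ?B = "\<lambda>k l. complex_of_real (B k l)"
  have A: "map_mat complex_of_real (class_mat N c D B) = class_mat N c ?D ?B"
    by (rule eq_matI) (auto simp: class_mat_def)
  have Q: "map_mat complex_of_real (quotient_mat m s D B) = quotient_mat m s ?D ?B"
    by (rule eq_matI) (auto simp: quotient_mat_def)
  have "char_poly (class_mat N c ?D ?B)
      = (\<Prod>k<m. [:- ?D k, 1:] ^ (s k - 1)) * char_poly (quotient_mat m s ?D ?B)"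
    by (rule char_poly_class_mat) (use assms in auto)
  \<comment> \<open>\<open>proots\<close> turns a product into a sum only if the factors are
    nonzero; a characteristic polynomial is monic.\<close>
  moreover have "char_poly (quotient_mat m s ?D ?B) \<noteq> 0"
    using degree_monic_char_poly[OF quotient_mat_carrier[of m s ?D ?B]] by auto
  moreover have "proots (\<Prod>k<m. [:- ?D k, 1:] ^ (s k - 1))
      = (\<Sum>k<m. replicate_mset (s k - 1) (?D k))"
    by (subst proots_prod) (auto simp: proots_power)
  ultimately show ?thesis
    by (simp add: spectrum_mset_def A Q proots_mult)
qed

section \<open>Distances 1 and 2 as infima of walk costs\<close>

lemma (in wf_digraph) mu_unit_eq:
  assumes "awalk u p v" and "\<And>q. awalk u q v \<Longrightarrow> length p \<le> length q"
  shows "\<mu> (\<lambda>_. 1) u v = ereal (real (length p))"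
proof -
  have cost: "awalk_cost (\<lambda>_. 1) q = real (length q)" for q
    by (induction q) auto
  show ?thesis
    unfolding \<mu>_def cost using assms
    by (intro antisym INF_greatest INF_lower2[of p]) auto
qed

lemma graph_dist_adjacent:
  assumes "pair_wf_digraph \<Gamma>" and "(u, v) \<in> parcs \<Gamma>" and "u \<noteq> v"
  shows "graph_dist \<Gamma> u v = 1"
proof -
  interpret pair_wf_digraph \<Gamma> by fact
  have "awalk u [(u, v)] v"
    using assms(2) by (auto simp: awalk_def in_arcsD1 in_arcsD2)
  moreover have "length [(u, v)] \<le> length q" if "awalk u q v" for q
    using that assms(3) by (cases q) (auto simp: awalk_def)
  ultimately have "\<mu> (\<lambda>_. 1) u v = ereal (real (length [(u, v)]))"
    by (rule mu_unit_eq)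
  then show ?thesis by (simp add: graph_dist_def)
qed

lemma graph_dist_common_neighbour:
  assumes "pair_wf_digraph \<Gamma>" and "(u, v) \<notin> parcs \<Gamma>" and "u \<noteq> v"
    and "(u, w) \<in> parcs \<Gamma>" and "(w, v) \<in> parcs \<Gamma>"
  shows "graph_dist \<Gamma> u v = 2"
proof -
  interpret pair_wf_digraph \<Gamma> by fact
  have "awalk u [(u, w), (w, v)] v"
    using assms(4,5) by (auto simp: awalk_def in_arcsD1 in_arcsD2)
  moreover have "length [(u, w), (w, v)] \<le> length q" if "awalk u q v" for q
  proof (rule ccontr)
    assume "\<not> ?thesis"
    \<comment> \<open>A walk with fewer than two arcs is empty, which forces \<open>u = v\<close>,
      or a single arc from \<open>u\<close> to \<open>v\<close>.\<close>
    then have "q = [] \<or> (\<exists>e. q = [e])" by (cases q; cases "tl q") auto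
    then show False using that assms(2,3) by (auto simp: awalk_def)
  qed
  ultimately have "\<mu> (\<lambda>_. 1) u v = ereal (real (length [(u, w), (w, v)]))"
    by (rule mu_unit_eq)
  then show ?thesis by (simp add: graph_dist_def)
qed

section \<open>Orders of elements and adjacency in the cyclic group\<close>

text \<open>Meant for \<open>x \<ge> 0\<close>, since \<open>nat\<close> truncates.\<close>

definition zmod_order :: "nat \<Rightarrow> int \<Rightarrow> nat" where
  "zmod_order n x = n div gcd (nat x) n"

lemma zmod_order_dvd: "zmod_order n x dvd n"
  unfolding zmod_order_def by (metis dvd_div_mult_self dvd_triv_left gcd_dvd2)

text \<open>Each order is the cofactor in \<open>n\<close> of a gcd, and passing to cofactors
  reverses divisibility. As \<open>gcd (nat x) n\<close> divides \<open>n\<close>, it divides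
  \<open>gcd (nat y) n\<close> as soon as it divides \<open>nat y\<close>.\<close>

lemma zmod_order_dvd_iff:
  assumes "0 < n"
  shows "zmod_order n y dvd zmod_order n x \<longleftrightarrow> gcd (nat x) n dvd nat y"
proof -
  have "zmod_order n y dvd zmod_order n x \<longleftrightarrow> gcd (nat x) n dvd gcd (nat y) n"
  proof -
    obtain a where a: "n = gcd (nat x) n * a" by (meson dvdE gcd_dvd2)
    obtain b where b: "n = gcd (nat y) n * b" by (meson dvdE gcd_dvd2)
    have gx: "gcd (nat x) n > 0" and gy: "gcd (nat y) n > 0" using assms by auto
    have oa: "zmod_order n x = a" unfolding zmod_order_def using a gx
      by (metis nonzero_mult_div_cancel_left not_gr_zero)
    have ob: "zmod_order n y = b" unfolding zmod_order_def using b gy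
      by (metis nonzero_mult_div_cancel_left not_gr_zero)
    have ab: "a > 0" "b > 0" using a b assms by (metis mult_0_right not_gr_zero)+
    have "b dvd a \<longleftrightarrow> gcd (nat x) n * b dvd gcd (nat x) n * a" using assms by simp
    also have "\<dots> \<longleftrightarrow> gcd (nat x) n * b dvd gcd (nat y) n * b" using a b by simp
    also have "\<dots> \<longleftrightarrow> gcd (nat x) n dvd gcd (nat y) n" using ab by simp
    finally show ?thesis by (simp add: oa ob)
  qed
  then show ?thesis by simp
qed

lemma zmod_order_dvd_iff_power:
  assumes "0 < n" and "x \<in> {0..<int n}" and "y \<in> {0..<int n}"
  shows "zmod_order n y dvd zmod_order n x \<longleftrightarrow>
    (\<exists>m::nat. m > 0 \<and> y = x [^]\<^bsub>integer_mod_group n\<^esub> m)"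
proof -
  obtain a b where x: "x = int a" and y: "y = int b" and b: "b < n"
    using assms by (metis atLeastLessThan_iff int_nat_eq nat_less_iff)
  have "gcd a n dvd b \<longleftrightarrow> (\<exists>m>0. b = m * a mod n)"
  proof
    assume "gcd a n dvd b"
    then obtain k where k: "b = gcd a n * k" by blast
    obtain z where z: "[a * z = gcd a n] (mod n)" using cong_solve_nat by (metis assms(1) not_gr_zero bezout_nat cong_def)
    \<comment> \<open>\<open>z\<close> is the Bezout coefficient and \<open>k\<close> the cofactor
      of \<open>b\<close>. Adding \<open>n\<close> keeps the residue and makes the exponent positive
      even if \<open>z * k = 0\<close>.\<close>
    have "[(z * k + n) * a = b] (mod n)"
    proof -
      have "[a * z * k + n * a = gcd a n * k + 0] (mod n)"
        using z by (intro cong_add cong_mult) (auto simp: cong_def)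
      then show ?thesis by (simp add: k algebra_simps)
    qed
    then have "b = (z * k + n) * a mod n" using b by (simp add: cong_def)
    then show "\<exists>m>0. b = m * a mod n" using assms(1) by (metis add_gr_0)
  next
    assume "\<exists>m>0. b = m * a mod n"
    then show "gcd a n dvd b" by (auto simp: dvd_mod_iff)
  qed
  also have "(\<exists>m>0. b = m * a mod n) \<longleftrightarrow>
      (\<exists>m::nat. m > 0 \<and> y = x [^]\<^bsub>integer_mod_group n\<^esub> m)"
    by (simp add: x y flip: of_nat_mult of_nat_mod)
  finally show ?thesis by (simp add: zmod_order_dvd_iff[OF assms(1)] x y)
qed

lemma parcs_power_graph_integer_mod_group:
  assumes "0 < n"
  shows "(x, y) \<in> parcs (power_graph (integer_mod_group n)) \<longleftrightarrow>
    x \<in> {0..<int n} \<and> y \<in> {0..<int n} \<and> x \<noteq> y \<and>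
    (zmod_order n y dvd zmod_order n x \<or> zmod_order n x dvd zmod_order n y)"
  using assms zmod_order_dvd_iff_power[OF assms, of x y] zmod_order_dvd_iff_power[OF assms, of y x]
  by (auto simp: power_graph_def carrier_integer_mod_group simp del: pow_integer_mod_group)

lemma zmod_order_0: "0 < n \<Longrightarrow> zmod_order n 0 = 1"
  by (simp add: zmod_order_def)

lemma zmod_order_eq_1_iff:
  assumes "0 < n" and "x \<in> {0..<int n}"
  shows "zmod_order n x = 1 \<longleftrightarrow> x = 0"
proof
  assume "zmod_order n x = 1"
  \<comment> \<open>The gcd on the left is \<open>n\<close>, and \<open>nat x < n\<close>.\<close>
  then have "gcd (nat 0) n dvd nat x"
    using zmod_order_dvd_iff[OF assms(1), of x 0] by simp
  then show "x = 0" using assms by (auto dest: dvd_imp_le)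
qed (simp add: zmod_order_0 assms)

lemma graph_dist_power_graph_integer_mod_group:
  assumes n: "0 < n" and x: "x \<in> {0..<int n}" and y: "y \<in> {0..<int n}" and ne: "x \<noteq> y"
  shows "graph_dist (power_graph (integer_mod_group n)) x y
    = div_dist (zmod_order n x) (zmod_order n y)"
proof -
  have "pair_graph (power_graph (integer_mod_group n))"
    by (rule pair_graph_power_graph) (use n in \<open>simp add: carrier_integer_mod_group\<close>)
  then interpret pair_graph "power_graph (integer_mod_group n)" .
  note wf = pair_wf_digraph and arc = parcs_power_graph_integer_mod_group[OF n]
  show ?thesis
  proof (cases "zmod_order n x dvd zmod_order n y \<or> zmod_order n y dvd zmod_order n x")
    case True
    then show ?thesis
      using graph_dist_adjacent[OF wf _ ne] x y ne by (auto simp: arc div_dist_def)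
  next
    case False
    \<comment> \<open>Incomparable orders exclude the identity, whose order is 1; it then serves as
      the common neighbour.\<close>
    then have "x \<noteq> 0" "y \<noteq> 0" using n by (auto simp: zmod_order_0)
    then show ?thesis
      using graph_dist_common_neighbour[OF wf _ ne, of 0] x y ne n False
      by (auto simp: arc div_dist_def zmod_order_0)
  qed
qed

text \<open>Order \<open>d\<close> means gcd \<open>n div d\<close> with \<open>n\<close>. The known
  count of such numbers runs over 1 to \<open>n\<close>, the group over 0 to \<open>n - 1\<close>;
  the bijection trades \<open>n\<close> for 0.\<close>

lemma card_zmod_order:
  assumes n: "0 < n" and d: "d dvd n"
  shows "card {x \<in> {0..<int n}. zmod_order n x = d} = totient d"
proof -
  have dn: "0 < d" "n div d dvd n" "n div (n div d) = d"
    using assms by (auto simp: div_dvd_iff_mult dvd_pos_nat)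
  have eq: "n div gcd k n = d \<longleftrightarrow> gcd k n = n div d" for k
    using n d dn by (metis dvd_div_eq_mult dvd_div_mult_self gcd_dvd2 nonzero_mult_div_cancel_left
        nonzero_mult_div_cancel_right dvd_0_left not_gr_zero)
  have "bij_betw (\<lambda>k. int (k mod n)) {k \<in> {0<..n}. gcd k n = n div d}
      {x \<in> {0..<int n}. zmod_order n x = d}"
  proof (rule bij_betw_byWitness[where f' = "\<lambda>x. if x = 0 then n else nat x"])
    show "\<forall>k\<in>{k \<in> {0<..n}. gcd k n = n div d}.
        (if int (k mod n) = 0 then n else nat (int (k mod n))) = k"
      using n by (auto dest: dvd_imp_le simp: le_less)
    show "(\<lambda>k. int (k mod n)) ` {k \<in> {0<..n}. gcd k n = n div d}
        \<subseteq> {x \<in> {0..<int n}. zmod_order n x = d}"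
      using n dn by (auto simp: zmod_order_def gcd_red_nat[symmetric] gcd.commute)
    show "\<forall>x\<in>{x \<in> {0..<int n}. zmod_order n x = d}.
        int ((if x = 0 then n else nat x) mod n) = x"
      using n by auto
    show "(\<lambda>x. if x = 0 then n else nat x) ` {x \<in> {0..<int n}. zmod_order n x = d}
        \<subseteq> {k \<in> {0<..n}. gcd k n = n div d}"
    proof (rule image_subsetI)
      fix x assume "x \<in> {x \<in> {0..<int n}. zmod_order n x = d}"
      then have x: "0 \<le> x" "x < int n" "gcd (nat x) n = n div d"
        by (auto simp: zmod_order_def eq)
      then show "(if x = 0 then n else nat x) \<in> {k \<in> {0<..n}. gcd k n = n div d}"
        using n by (cases "x = 0") auto
    qed
  qed
  then show ?thesis
    using card_gcd_eq_totient[OF n dn(2)] dn(3) by (simp add: bij_betw_same_card)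
qed

section \<open>The spectrum for the cyclic group\<close>

theorem theorem3p1:
  fixes \<alpha> :: real and n :: nat and ds :: "nat list" and vs :: "int list"
  assumes "0 \<le> \<alpha>" and "\<alpha> \<le> 1" and "3 \<le> n"
    and "distinct ds" and "set ds = {d. d dvd n \<and> 1 < d \<and> d < n}"
    and "distinct vs" and "set vs = pverts (power_graph (integer_mod_group n))"
  shows "spectrum_mset (RD_alpha \<alpha> (power_graph (integer_mod_group n)) vs) =
      replicate_mset (totient n) (complex_of_real (real n * \<alpha> - 1))
    + (\<Sum>i<length ds. replicate_mset (totient (ds ! i) - 1)
        (complex_of_real
          ((real (totient n) + real (totient (ds ! i)) + cross_sum ds i + 1) * \<alpha> - 1)))
    + spectrum_mset (Q_RD_alpha \<alpha> n ds)"
proof -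
  let ?V = "{0..<int n}" and ?G = "power_graph (integer_mod_group n)"
  \<comment> \<open>The list gets all divisors above 1, with the order \<open>n\<close> at index 0
    to match row 0 of the quotient matrix. The extra 1 in \<open>s 0\<close> counts the identity,
    which joins the generators.\<close>
  define es where "es = n # ds"
  define m where "m = Suc (length ds)"
  define s where "s = case_nat (totient n + 1) (\<lambda>i. totient (ds ! i))"
  define dd where "dd k l = div_dist (es ! k) (es ! l)" for k l
  \<comment> \<open>The reciprocal distance sum from a vertex of class \<open>k\<close>, with the
    vertex itself counted once since \<open>dd k k = 1\<close>; the transmission is therefore
    \<open>T k - 1\<close>.\<close>
  define T where "T k = (\<Sum>l<m. real (s l) / dd k l)" for k
  \<comment> \<open>What remains of the diagonal entry \<open>\<alpha> * (T k - 1)\<close> after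
    subtracting \<open>B k k = 1 - \<alpha>\<close>.\<close>
  define D where "D k = \<alpha> * T k - 1" for k
  define B where "B k l = (1 - \<alpha>) / dd k l" for k l
  note n = \<open>3 \<le> n\<close>
  then have n0: "0 < n" by simp
  have V: "set vs = ?V" and pV: "pverts ?G = ?V"
    using assms(7) n0 by (auto simp: power_graph_def carrier_integer_mod_group)
  have "set es = insert n {d. d dvd n \<and> 1 < d \<and> d < n}"
    unfolding es_def list.set assms(5) ..
  also have "\<dots> = {d. d dvd n \<and> 1 < d}"
  proof (rule Set.set_eqI)
    fix d
    show "d \<in> insert n {d. d dvd n \<and> 1 < d \<and> d < n} \<longleftrightarrow> d \<in> {d. d dvd n \<and> 1 < d}"
      using n dvd_imp_le[OF _ n0, of d] by (cases "d = n") auto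
  qed
  finally have set_es: "set es = {d. d dvd n \<and> 1 < d}" .
  have "n \<notin> set ds" unfolding assms(5) by simp
  then have es: "distinct es" "length es = m" "es ! 0 = n"
    using assms(4) by (simp_all add: es_def m_def)
  have es_dvd: "es ! k dvd n" and es_gt: "1 < es ! k" if "k < m" for k
    using nth_mem[of k es] that unfolding set_es es(2) by simp_all
  have m0: "0 < m" by (simp add: m_def)

  \<comment> \<open>Existence and uniqueness of the class in one formula, so that the choice
    function \<open>cls\<close> comes with a full characterization. Uniqueness holds because
    \<open>es\<close> is distinct and all its entries exceed 1.\<close>
  have "\<exists>k<m. \<forall>l<m. l = k \<longleftrightarrow>
      zmod_order n v = es ! l \<or> zmod_order n v = 1 \<and> l = 0" for v
  proof (cases "zmod_order n v = 1")
    case True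
    then show ?thesis using m0 es_gt by (intro exI[of _ 0]) fastforce
  next
    case False
    moreover have "0 < zmod_order n v"
      using zmod_order_dvd n0 by (rule dvd_pos_nat[rotated])
    ultimately have "zmod_order n v \<in> set es"
      using zmod_order_dvd set_es by auto
    then obtain k where "k < m" "es ! k = zmod_order n v"
      using es(2) by (auto simp: in_set_conv_nth)
    then show ?thesis
      using False es(1,2) by (intro exI[of _ k]) (auto simp: nth_eq_iff_index_eq)
  qed
  then obtain cls where cls_less: "cls v < m"
    and cls_iff: "\<And>l. l < m \<Longrightarrow> l = cls v \<longleftrightarrow>
      zmod_order n v = es ! l \<or> zmod_order n v = 1 \<and> l = 0" for v
    by metis

  \<comment> \<open>Both 1 and \<open>n\<close> are comparable to every divisor of \<open>n\<close>, so the order \<open>n\<close> may stand in for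
    that of the identity.\<close>
  have dd_eq: "dd (cls v) (cls w) = div_dist (zmod_order n v) (zmod_order n w)" for v w
  proof -
    have v: "zmod_order n v = es ! cls v \<or> zmod_order n v = 1 \<and> cls v = 0"
      and w: "zmod_order n w = es ! cls w \<or> zmod_order n w = 1 \<and> cls w = 0"
      using cls_iff cls_less by blast+
    then show ?thesis
      using es(3) es_dvd[OF cls_less] zmod_order_dvd
      by (auto simp: dd_def div_dist_def)
  qed
  have dd_self: "dd k k = 1" for k by (simp add: dd_def div_dist_def)
  have dd_0: "dd 0 k = 1" "dd k 0 = 1" if "k < m" for k
    using es_dvd[OF that] es(3) by (auto simp: dd_def div_dist_def)
  have dd_Suc: "dd (Suc i) (Suc k) = div_dist (ds ! i) (ds ! k)" for i k
    by (simp add: dd_def es_def)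

  have card_cls: "card {v \<in> ?V. cls v = k} = s k" if "k < m" for k
  proof -
    have cls_eq: "cls v = k \<longleftrightarrow> zmod_order n v = es ! k \<or> zmod_order n v = 1 \<and> k = 0" for v
      using cls_iff[OF that, of v] by (metis (no_types))
    have set_eq: "{v \<in> ?V. cls v = k} = {v \<in> ?V. zmod_order n v = es ! k}
        \<union> {v \<in> ?V. zmod_order n v = 1 \<and> k = 0}"
      unfolding cls_eq by auto
    show ?thesis
    proof (cases k)
      \<comment> \<open>Since \<open>es ! 0 = n > 1\<close>, the identity is not among the
        generators and raises the count by one.\<close>
      case 0
      have "{v \<in> ?V. zmod_order n v = 1 \<and> k = 0} = {0}"
        using 0 n0 zmod_order_eq_1_iff by auto
      moreover have "0 \<notin> {v \<in> ?V. zmod_order n v = es ! k}"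
        using es_gt[OF that] n0 by (simp add: zmod_order_0)
      moreover have "finite {v \<in> ?V. zmod_order n v = es ! k}"
        by (rule finite_subset[of _ ?V]) auto
      ultimately have "card {v \<in> ?V. cls v = k} = Suc (card {v \<in> ?V. zmod_order n v = es ! k})"
        unfolding set_eq by (metis Un_insert_right Un_empty_right card_insert_disjoint)
      then show ?thesis
        using card_zmod_order[OF n0 es_dvd[OF that]] by (simp add: 0 s_def es(3))
    next
      case (Suc i)
      then have "card {v \<in> ?V. cls v = k} = card {v \<in> ?V. zmod_order n v = es ! k}"
        unfolding set_eq by simp
      then show ?thesis
        using card_zmod_order[OF n0 es_dvd[OF that]] by (simp add: Suc s_def es_def)
    qed
  qed
  have card_idx: "s k = card {i. i < length vs \<and> cls (vs ! i) = k}" if "k < m" for k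
  proof -
    have "bij_betw ((!) vs) {i. i < length vs \<and> cls (vs ! i) = k} {v \<in> ?V. cls v = k}"
      unfolding bij_betw_def V[symmetric]
      using \<open>distinct vs\<close> by (auto simp: inj_on_def nth_eq_iff_index_eq in_set_conv_nth)
    then show ?thesis using card_cls[OF that] by (simp add: bij_betw_same_card)
  qed
  have s_pos: "0 < s k" if "k < m" for k
  proof (cases k)
    case (Suc i)
    then show ?thesis using es_gt[OF that] by (simp add: s_def es_def)
  qed (simp add: s_def)

  have sum_cls: "(\<Sum>v\<in>?V. f (cls v)) = (\<Sum>k<m. real (s k) * f k)" for f
    by (subst sum_fun_comp[of ?V "{..<m}"]) (use cls_less card_cls in auto)
  \<comment> \<open>Class 0 has distance value 1 to every class, so all \<open>n\<close> group
    elements are counted with weight 1.\<close>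
  have T_0: "T 0 = real n"
  proof -
    have "T 0 = (\<Sum>k<m. real (s k) * 1)" unfolding T_def by (simp add: dd_0)
    also have "\<dots> = real n" by (subst sum_cls[symmetric]) simp
    finally show ?thesis .
  qed
  \<comment> \<open>Class 0 contributes \<open>totient n + 1\<close>, the own class its size, and
    the other classes \<open>cross_sum\<close>.\<close>
  have T_Suc: "T (Suc i) = real (totient n) + real (totient (ds ! i)) + cross_sum ds i + 1"
    if "i < length ds" for i
  proof -
    have "T (Suc i) = real (totient n + 1) / dd (Suc i) 0
        + (\<Sum>k<length ds. real (totient (ds ! k)) / dd (Suc i) (Suc k))"
      unfolding T_def m_def by (subst sum.lessThan_Suc_shift) (simp add: s_def)
    also have "(\<Sum>k<length ds. real (totient (ds ! k)) / dd (Suc i) (Suc k))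
        = real (totient (ds ! i)) + cross_sum ds i"
      using that by (subst sum.remove[of _ i]) (auto simp: cross_sum_def dd_self
          simp flip: dd_Suc)
    finally show ?thesis using that by (simp add: dd_0 m_def)
  qed

  have dist: "graph_dist ?G v w = dd (cls v) (cls w)" if "v \<in> ?V" "w \<in> ?V" "v \<noteq> w" for v w
    using graph_dist_power_graph_integer_mod_group[OF n0 that] by (simp add: dd_eq)
  have RT: "reciprocal_transmission ?G v = T (cls v) - 1" if "v \<in> ?V" for v
  proof -
    have "reciprocal_transmission ?G v = (\<Sum>u\<in>?V - {v}. 1 / dd (cls v) (cls u))"
      unfolding reciprocal_transmission_def pV using that by (intro sum.cong) (auto simp: dist)
    also have "\<dots> = (\<Sum>u\<in>?V. 1 / dd (cls v) (cls u)) - 1"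
      using that by (simp add: sum_diff1 dd_self)
    also have "\<dots> = T (cls v) - 1" by (subst sum_cls) (simp add: T_def)
    finally show ?thesis .
  qed

  have "RD_alpha \<alpha> ?G vs = class_mat (length vs) (\<lambda>i. cls (vs ! i)) D B"
  proof (rule eq_matI)
    fix i j assume "i < dim_row (class_mat (length vs) (\<lambda>i. cls (vs ! i)) D B)"
      and "j < dim_col (class_mat (length vs) (\<lambda>i. cls (vs ! i)) D B)"
    then have ij: "i < length vs" "j < length vs" by (auto simp: class_mat_def)
    then have v: "vs ! i \<in> ?V" "vs ! j \<in> ?V" using V nth_mem by blast+
    show "RD_alpha \<alpha> ?G vs $$ (i, j)
      = class_mat (length vs) (\<lambda>i. cls (vs ! i)) D B $$ (i, j)"
    proof (cases "i = j")
      case True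
      then show ?thesis
        using ij by (simp add: RD_alpha_def RD_def RT_def mat_diag_def class_mat_def
            D_def B_def dd_self RT[OF v(1)[unfolded True]] algebra_simps)
    next
      case False
      then have "vs ! i \<noteq> vs ! j" using ij \<open>distinct vs\<close> by (simp add: nth_eq_iff_index_eq)
      then show ?thesis
        using False ij dist[OF v] by (simp add: RD_alpha_def RD_def RT_def mat_diag_def
            class_mat_def B_def)
    qed
  qed (auto simp: RD_alpha_def RD_def RT_def class_mat_def)
  \<comment> \<open>On the diagonal, \<open>D k + B k k * s k\<close> simplifies to the stated
    entry; at 0 it is \<open>\<alpha> * n - 1 + (1 - \<alpha>) * (totient n + 1)\<close>.\<close>
  moreover have "Q_RD_alpha \<alpha> n ds = quotient_mat m s D B"
    by (rule eq_matI)
      (auto simp: Q_RD_alpha_def quotient_mat_def m_def s_def D_def B_def T_0 T_Suc h_entry_def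
        dd_0 dd_self dd_Suc algebra_simps split: nat.split)
  moreover have "spectrum_mset (class_mat (length vs) (\<lambda>i. cls (vs ! i)) D B)
      = (\<Sum>k<m. replicate_mset (s k - 1) (complex_of_real (D k)))
        + spectrum_mset (quotient_mat m s D B)"
    by (rule spectrum_mset_class_mat) (use cls_less card_idx s_pos in auto)
  \<comment> \<open>Class 0 is split off: its size \<open>totient n + 1\<close> leaves multiplicity
    \<open>totient n\<close>.\<close>
  moreover have "(\<Sum>k<m. replicate_mset (s k - 1) (complex_of_real (D k)))
      = replicate_mset (totient n) (complex_of_real (real n * \<alpha> - 1))
        + (\<Sum>i<length ds. replicate_mset (totient (ds ! i) - 1)
          (complex_of_real
            ((real (totient n) + real (totient (ds ! i)) + cross_sum ds i + 1) * \<alpha> - 1)))"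
    unfolding m_def sum.lessThan_Suc_shift
    by (intro arg_cong2[where f = plus] sum.cong refl)
      (simp_all add: s_def D_def T_0 T_Suc mult.commute)
  ultimately show ?thesis by simp
qed

end
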